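(* Let $P$ be a finite bounded poset admitting a recursive first atom set $\Omega$, and let $\mathcal{M}_\Omega$ be the set of maximal chains of $P$ partially ordered by $\preceq$. Then any linear extension of $\mathcal{M}_\Omega$ gives a shelling order of the order complex $\Delta(P)$.
   Context: A poset is bounded if it has a unique minimum $\hat 0$ and maximum $\hat 1$; $x\lessdot y$ denotes a cover relation; the length of $P$ is the length of its longest chain. The order complex $\Delta(P)$ is the simplicial complex whose faces are the chains of $P$; its facets are the maximal chains. An ordering $F_1,\dots,F_s$ of the facets of a simplicial complex is a shelling order if for each $1<j\le s$, $\overline{F_j}\cap\bigl(\bigcup_{i<j}\overline{F_i}\bigr)$ is pure of dimension $\dim F_j-1$. A root of $x$ is a maximal chain of $[\hat0,x]$; a rooted interval $[x,y]_r$ is an interval with a root $r$ of $x$. For a chain $m$ containing $x$, $m^x=\{w\in m:w\le x\}$; $r\cup a$ means $r\cup\{a\}$. RFAS: $P$ admits a recursive first atom set if $P$ has length 1, or if for each $x<y$ in $P$ and each root $r$ of $x$ there is an atom $\Omega(r,x,y)$ of $[x,y]$ such that, whenever $a$ is an atom of $[x,y]$ with $a<y$ and $b=\Omega(r\cup a,a,y)$: (i) $a=\Omega(r,x,y)$ iff $a=\Omega(r,x,b)$; (ii) if $a\ne\Omega(r,x,y)=:a'$, there exist atoms $a_1,\dots,a_p$ of $[x,y]$ and elements $b_1,\dots,b_{p-1}$ with $a_p=\Omega(r,x,b)$, $a_1=a'$, and for all $1\le i\le p-1$, $b_i=\Omega(r\cup a_{i+1},a_{i+1},y)$ and $a_i=\Omega(r,x,b_i)$.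 The first atom chain $c(r,x,y)$ is the unique maximal chain $x=z_0\lessdot z_1\lessdot\cdots\lessdot z_q=y$ of $[x,y]$ with $z_{i+1}=\Omega(r\cup\{z_1,\dots,z_i\},z_i,y)$ for $0\le i\le q-2$. For a maximal chain $m:\hat0=x_0\lessdot\cdots\lessdot x_n=\hat1$ of $P$, $x_i\lessdot x_{i+1}\lessdot x_{i+2}$ is a pseudo descent of $m$ if $x_{i+1}\ne\Omega(m^{x_i},x_i,x_{i+2})$. For maximal chains $m,m'$ of $P$, $m\to m'$ means there are $x\lessdot y\lessdot z$ with $x,z\in m\cap m'$, $m$ and $m'$ agree below $x$ and above $z$, $x\lessdot y\lessdot z$ is a pseudo descent of $m'$, and the portion of $m$ between $x$ and $z$ is $c(m^x,x,z)$. $\preceq$ is the reflexive and transitive closure of all relations $m\to m'$ (it is a partial order on the set of maximal chains). *)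

theory Defs
  imports Main
begin

definition covers :: "'a::order \<Rightarrow> 'a \<Rightarrow> bool" where
  "covers x y \<longleftrightarrow> x < y \<and> (\<nexists>w. x < w \<and> w < y)"

definition is_atom :: "'a::order \<Rightarrow> 'a \<Rightarrow> 'a \<Rightarrow> bool" where
  "is_atom x y a \<longleftrightarrow> a \<in> {x..y} \<and> covers x a"

abbreviation is_chain :: "'a::order set \<Rightarrow> 'a set \<Rightarrow> bool" where
  "is_chain A \<equiv> pred_on.chain A (<)"

abbreviation is_maxchain :: "'a::order set \<Rightarrow> 'a set \<Rightarrow> bool" where
  "is_maxchain A \<equiv> pred_on.maxchain A (<)"

text \<open>A chain with \<open>k + 1\<close> elements has length \<open>k\<close>. The empty chain is counted with the
  truncated length 0, which does not affect the maximum over a nonempty poset.\<close>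

definition poset_length :: "'a::order set \<Rightarrow> nat" where
  "poset_length A = Max ((\<lambda>C. card C - 1) ` {C. is_chain A C})"

text \<open>A finite bounded poset is a type of sort \<open>{finite, order_bot, order_top}\<close>.\<close>

definition is_root :: "'a::{order_bot, order_top} \<Rightarrow> 'a set \<Rightarrow> bool" where
  "is_root x r \<longleftrightarrow> is_maxchain {bot..x} r"

definition maximal_chains :: "'a::{order_bot, order_top} set set" where
  "maximal_chains = {m. is_maxchain UNIV m}"

text \<open>\<open>below m x\<close> is written $m^x$ in the literature.\<close>

definition below :: "'a::order set \<Rightarrow> 'a \<Rightarrow> 'a set" where
  "below m x = {w \<in> m. w \<le> x}"

text \<open>A complex is a family of finite sets closed under subsets; the empty face is included,
  with dimension \<open>-1\<close>.\<close>

definition order_complex :: "'a::order set \<Rightarrow> 'a set set" where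
  "order_complex A = {\<sigma>. finite \<sigma> \<and> is_chain A \<sigma>}"

definition face_dim :: "'v set \<Rightarrow> int" where
  "face_dim \<sigma> = int (card \<sigma>) - 1"

definition facets :: "'v set set \<Rightarrow> 'v set set" where
  "facets K = {F \<in> K. \<forall>G \<in> K. F \<subseteq> G \<longrightarrow> G = F}"

definition pure_of_dim :: "'v set set \<Rightarrow> int \<Rightarrow> bool" where
  "pure_of_dim K d \<longleftrightarrow> K \<noteq> {} \<and> (\<forall>F \<in> facets K. face_dim F = d)"

text \<open>\<open>Pow F\<close> is the complex of all faces of \<open>F\<close>. Lists are indexed from 0.\<close>

definition shelling_order :: "'v set set \<Rightarrow> 'v set list \<Rightarrow> bool" where
  "shelling_order K Fs \<longleftrightarrow> distinct Fs \<and> set Fs = facets K \<and>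
     (\<forall>j. 0 < j \<and> j < length Fs \<longrightarrow>
        pure_of_dim (Pow (Fs ! j) \<inter> (\<Union>i<j. Pow (Fs ! i))) (face_dim (Fs ! j) - 1))"

text \<open>\<open>\<Omega> r x y\<close> is only meaningful if \<open>x < y\<close> and \<open>r\<close> is a root of \<open>x\<close>; other values are
  unconstrained. In the second conjunct the sequences \<open>as\<close>, \<open>bs\<close> are indexed by
  \<open>1, \<dots>, p\<close> and \<open>1, \<dots>, p - 1\<close>.\<close>

definition recursive_first_atom_set ::
  "('a::{finite, order_bot, order_top} set \<Rightarrow> 'a \<Rightarrow> 'a \<Rightarrow> 'a) \<Rightarrow> bool" where
  "recursive_first_atom_set \<Omega> \<longleftrightarrow>
     poset_length (UNIV :: 'a set) = 1 \<or>
     (\<forall>x y r. x < y \<and> is_root x r \<longrightarrow>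
        is_atom x y (\<Omega> r x y) \<and>
        (\<forall>a b. is_atom x y a \<and> a < y \<and> b = \<Omega> (insert a r) a y \<longrightarrow>
           (a = \<Omega> r x y \<longleftrightarrow> a = \<Omega> r x b) \<and>
           (a \<noteq> \<Omega> r x y \<longrightarrow>
              (\<exists>p as bs. 1 \<le> (p::nat) \<and>
                 (\<forall>i \<in> {1..p}. is_atom x y (as i)) \<and>
                 as p = \<Omega> r x b \<and> as 1 = \<Omega> r x y \<and>
                 (\<forall>i. 1 \<le> i \<and> i < p \<longrightarrow>
                    bs i = \<Omega> (insert (as (i + 1)) r) (as (i + 1)) y \<and>
                    as i = \<Omega> r x (bs i))))))"

definition is_first_atom_chain ::
  "('a::{finite, order_bot, order_top} set \<Rightarrow> 'a \<Rightarrow> 'a \<Rightarrow> 'a) \<Rightarrow> 'a set \<Rightarrow> 'a \<Rightarrow> 'a \<Rightarrow> 'a set \<Rightarrow> bool"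
where
  "is_first_atom_chain \<Omega> r x y c \<longleftrightarrow>
     (\<exists>q z. c = z ` {0..(q::nat)} \<and> z 0 = x \<and> z q = y \<and>
        (\<forall>i<q. covers (z i) (z (i + 1))) \<and>
        (\<forall>i. i + 2 \<le> q \<longrightarrow> z (i + 1) = \<Omega> (r \<union> z ` {1..i}) (z i) y))"

definition first_atom_chain ::
  "('a::{finite, order_bot, order_top} set \<Rightarrow> 'a \<Rightarrow> 'a \<Rightarrow> 'a) \<Rightarrow> 'a set \<Rightarrow> 'a \<Rightarrow> 'a \<Rightarrow> 'a set"
where
  "first_atom_chain \<Omega> r x y = (THE c. is_first_atom_chain \<Omega> r x y c)"

text \<open>If \<open>x\<close>, \<open>y\<close>, \<open>z\<close> lie on a chain and \<open>y\<close> covers \<open>x\<close>, \<open>z\<close> covers \<open>y\<close>, then they are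
  consecutive elements of that chain.\<close>

definition pseudo_descent ::
  "('a::{finite, order_bot, order_top} set \<Rightarrow> 'a \<Rightarrow> 'a \<Rightarrow> 'a) \<Rightarrow> 'a set \<Rightarrow> 'a \<Rightarrow> 'a \<Rightarrow> 'a \<Rightarrow> bool"
where
  "pseudo_descent \<Omega> m x y z \<longleftrightarrow>
     {x, y, z} \<subseteq> m \<and> covers x y \<and> covers y z \<and> y \<noteq> \<Omega> (below m x) x z"

definition chain_step ::
  "('a::{finite, order_bot, order_top} set \<Rightarrow> 'a \<Rightarrow> 'a \<Rightarrow> 'a) \<Rightarrow> 'a set \<Rightarrow> 'a set \<Rightarrow> bool"
where
  "chain_step \<Omega> m m' \<longleftrightarrow> m \<in> maximal_chains \<and> m' \<in> maximal_chains \<and>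
     (\<exists>x y z. covers x y \<and> covers y z \<and> {x, z} \<subseteq> m \<inter> m' \<and>
        below m x = below m' x \<and> {w \<in> m. z \<le> w} = {w \<in> m'. z \<le> w} \<and>
        pseudo_descent \<Omega> m' x y z \<and>
        m \<inter> {x..z} = first_atom_chain \<Omega> (below m x) x z)"

definition chain_le ::
  "('a::{finite, order_bot, order_top} set \<Rightarrow> 'a \<Rightarrow> 'a \<Rightarrow> 'a) \<Rightarrow> 'a set \<Rightarrow> 'a set \<Rightarrow> bool"
where
  "chain_le \<Omega> = (chain_step \<Omega>)\<^sup>*\<^sup>*"

text \<open>A linear extension of the finite set \<open>A\<close>, partially ordered by \<open>le\<close>, is given by listing
  its elements in increasing order.\<close>

definition linear_extension :: "'b set \<Rightarrow> ('b \<Rightarrow> 'b \<Rightarrow> bool) \<Rightarrow> 'b list \<Rightarrow> bool" where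
  "linear_extension A le xs \<longleftrightarrow> distinct xs \<and> set xs = A \<and>
     (\<forall>i<length xs. \<forall>j<length xs. le (xs ! i) (xs ! j) \<longrightarrow> i \<le> j)"

end

theory Submission
  imports Defs
begin

text \<open>A chain of a rooted interval without pseudo descents is the first atom chain, and every
  maximal chain of a rooted interval lies above the first atom chain: straighten the part above
  its first element \<open>a\<close>, and then walk down along \<open>a\<^sub>p, \<dots>, a\<^sub>1\<close> by steps at the bottom. Hence if
  \<open>m'\<close> has no pseudo descent whose middle element lies outside \<open>m\<close>, replacing the gaps of \<open>m\<close>
  by those of \<open>m'\<close>, from the bottom up, gives \<open>m' \<preceq> m\<close>. So if \<open>m\<close> precedes \<open>m'\<close> in a linear
  extension, \<open>m'\<close> has a pseudo descent \<open>x \<lessdot> v \<lessdot> z\<close> with \<open>v \<notin> m\<close>, and straightening it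
  yields an earlier maximal chain that contains \<open>m' - {v}\<close>.\<close>

section \<open>Maximal chains of intervals\<close>

lemma is_chain_iff:
  fixes A :: "'a::order set"
  shows "is_chain A c \<longleftrightarrow> c \<subseteq> A \<and> (\<forall>u\<in>c. \<forall>v\<in>c. u \<le> v \<or> v \<le> u)"
  unfolding pred_on.chain_def by (auto simp: order.order_iff_strict)

text \<open>A chain that can be enlarged at all can be enlarged by a single element, so maximality
  becomes a pointwise test of comparability.\<close>

lemma is_maxchain_iff:
  fixes A :: "'a::order set"
  shows "is_maxchain A c \<longleftrightarrow>
    c \<subseteq> A \<and> (\<forall>u\<in>c. \<forall>v\<in>c. u \<le> v \<or> v \<le> u) \<and> (\<forall>w\<in>A. (\<forall>u\<in>c. u \<le> w \<or> w \<le> u) \<longrightarrow> w \<in> c)"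
    (is "?L \<longleftrightarrow> ?R")
proof
  assume L: ?L
  then have c: "is_chain A c" and mx: "\<not> (\<exists>S. is_chain A S \<and> c \<subset> S)"
    unfolding pred_on.maxchain_def by auto
  have "w \<in> c" if "w \<in> A" "\<forall>u\<in>c. u \<le> w \<or> w \<le> u" for w
  proof (rule ccontr)
    assume "w \<notin> c"
    then have "is_chain A (insert w c)" "c \<subset> insert w c"
      using c that unfolding is_chain_iff by auto
    then show False using mx by blast
  qed
  then show ?R using c unfolding is_chain_iff by blast
next
  assume R: ?R
  have "\<not> (\<exists>S. is_chain A S \<and> c \<subset> S)"
    using R unfolding is_chain_iff by blast
  then show ?L using R unfolding pred_on.maxchain_def is_chain_iff by blast
qed

lemma is_maxchainD:
  fixes A :: "'a::order set"
  assumes "is_maxchain A c"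
  shows "c \<subseteq> A" "\<And>u v. u \<in> c \<Longrightarrow> v \<in> c \<Longrightarrow> u \<le> v \<or> v \<le> u"
    "\<And>w. w \<in> A \<Longrightarrow> (\<And>u. u \<in> c \<Longrightarrow> u \<le> w \<or> w \<le> u) \<Longrightarrow> w \<in> c"
  using assms unfolding is_maxchain_iff by blast+

lemma is_maxchain_interval_ends:
  fixes x y :: "'a::order"
  assumes "is_maxchain {x..y} c" "x \<le> y"
  shows "x \<in> c" "y \<in> c"
proof -
  have bd: "x \<le> u" "u \<le> y" if "u \<in> c" for u
    using is_maxchainD(1)[OF assms(1)] that by auto
  show "x \<in> c" "y \<in> c"
    by (rule is_maxchainD(3)[OF assms(1)]; use assms(2) bd in simp)+
qed

lemma is_maxchain_singleton:
  fixes x :: "'a::order"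
  shows "is_maxchain {x} c \<longleftrightarrow> c = {x}"
  unfolding is_maxchain_iff by auto

lemma covers_le_cases:
  assumes "covers x a" "x \<le> w" "w \<le> a"
  shows "w = x \<or> w = a"
  using assms unfolding covers_def by (auto simp: order.order_iff_strict)

lemma is_maxchain_covers:
  assumes "covers x a"
  shows "is_maxchain {x..a} {x, a}"
proof -
  have "x \<le> a" using assms by (auto simp: covers_def)
  moreover have "w \<in> {x, a}" if "w \<in> {x..a}" for w
    using covers_le_cases[OF assms] that by simp
  ultimately show ?thesis unfolding is_maxchain_iff by simp
qed

text \<open>The gluing point \<open>y\<close> lies in \<open>c\<close>, so an element comparable
  with the union is comparable with \<open>y\<close> and falls into one of the two intervals, where
  maximality of that piece applies.\<close>

lemma is_maxchain_join:
  fixes x y z :: "'a::order"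
  assumes c: "is_maxchain {x..y} c" and d: "is_maxchain {y..z} d" and "x \<le> y" "y \<le> z"
  shows "is_maxchain {x..z} (c \<union> d)"
proof -
  have cs: "c \<subseteq> {x..y}" and ds: "d \<subseteq> {y..z}"
    using is_maxchainD(1)[OF c] is_maxchainD(1)[OF d] .
  have "w \<in> c \<union> d" if w: "w \<in> {x..z}" and cmp: "\<And>u. u \<in> c \<union> d \<Longrightarrow> u \<le> w \<or> w \<le> u" for w
  proof -
    have "w \<le> y \<or> y \<le> w"
      using cmp is_maxchain_interval_ends(2)[OF c \<open>x \<le> y\<close>] by blast
    then show ?thesis
      using is_maxchainD(3)[OF c, of w] is_maxchainD(3)[OF d, of w] w cmp by auto
  qed
  moreover have "u \<le> v \<or> v \<le> u" if "u \<in> c \<union> d" "v \<in> c \<union> d" for u v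
    using that is_maxchainD(2)[OF c, of u v] is_maxchainD(2)[OF d, of u v] cs ds
    by (force intro: order.trans)
  moreover have "c \<union> d \<subseteq> {x..z}"
    using cs ds \<open>x \<le> y\<close> \<open>y \<le> z\<close> by (force intro: order.trans)
  ultimately show ?thesis unfolding is_maxchain_iff by blast
qed

text \<open>For \<open>w\<close> below \<open>y\<close>, comparability with the part of
  \<open>m\<close> below \<open>y\<close> already gives comparability with all of \<open>m\<close>,
  since the rest lies above \<open>y\<close>; so maximality of \<open>m\<close> applies.\<close>

lemma is_maxchain_lower:
  fixes x y z :: "'a::order"
  assumes m: "is_maxchain {x..z} m" and "y \<in> m"
  shows "is_maxchain {x..y} (m \<inter> {..y})"
proof -
  have y: "x \<le> y" "y \<le> z" using is_maxchainD(1)[OF m] \<open>y \<in> m\<close> by auto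
  have "w \<in> m" if w: "w \<in> {x..y}" and cmp: "\<forall>u\<in>m \<inter> {..y}. u \<le> w \<or> w \<le> u" for w
  proof (rule is_maxchainD(3)[OF m])
    show "w \<in> {x..z}" using w y by auto
    show "u \<le> w \<or> w \<le> u" if "u \<in> m" for u
      using is_maxchainD(2)[OF m that \<open>y \<in> m\<close>] cmp w that by (auto intro: order.trans)
  qed
  then show ?thesis
    using is_maxchainD(1,2)[OF m] y unfolding is_maxchain_iff by auto
qed

lemma is_maxchain_upper:
  fixes x y z :: "'a::order"
  assumes m: "is_maxchain {x..z} m" and "y \<in> m"
  shows "is_maxchain {y..z} (m \<inter> {y..})"
proof -
  have y: "x \<le> y" "y \<le> z" using is_maxchainD(1)[OF m] \<open>y \<in> m\<close> by auto
  have "w \<in> m" if w: "w \<in> {y..z}" and cmp: "\<forall>u\<in>m \<inter> {y..}. u \<le> w \<or> w \<le> u" for w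
  proof (rule is_maxchainD(3)[OF m])
    show "w \<in> {x..z}" using w y by auto
    show "u \<le> w \<or> w \<le> u" if "u \<in> m" for u
      using is_maxchainD(2)[OF m that \<open>y \<in> m\<close>] cmp w that by (auto intro: order.trans)
  qed
  then show ?thesis
    using is_maxchainD(1,2)[OF m] y unfolding is_maxchain_iff by auto
qed

text \<open>A minimal element of \<open>c - {x}\<close> is its least one, and anything strictly
  between it and \<open>x\<close> would be comparable with all of \<open>c\<close>. This drives the
  inductions that climb along a chain.\<close>

lemma is_maxchain_first_step:
  fixes x y :: "'a::{finite, order}"
  assumes c: "is_maxchain {x..y} c" and "x < y"
  obtains a c' where "covers x a" "a \<le> y" "is_maxchain {a..y} c'" "c = insert x c'" "a \<in> c'"
proof -
  have ends: "x \<in> c" "y \<in> c" using is_maxchain_interval_ends[OF c] \<open>x < y\<close> by auto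
  have "finite (c - {x})" "c - {x} \<noteq> {}" using ends \<open>x < y\<close> by auto
  then obtain a where a: "a \<in> c - {x}" and amin: "\<forall>b\<in>c - {x}. b \<le> a \<longrightarrow> a = b"
    using finite_has_minimal by meson
  have ac: "a \<in> c" "x < a" "a \<le> y"
    using a is_maxchainD(1)[OF c] by (auto simp: order.order_iff_strict)
  have above: "a \<le> b" if "b \<in> c" "b \<noteq> x" for b
    using amin is_maxchainD(2)[OF c, of a b] that ac by auto
  have "\<not> (x < w \<and> w < a)" for w
  proof
    assume w: "x < w \<and> w < a"
    have "w \<in> c"
    proof (rule is_maxchainD(3)[OF c])
      show "w \<in> {x..y}" using w ac by auto
      show "u \<le> w \<or> w \<le> u" if "u \<in> c" for u
        using above[OF that] w by (cases "u = x") auto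
    qed
    moreover have "w \<noteq> x" "\<not> a \<le> w" using w by auto
    ultimately show False using above by blast
  qed
  then have "covers x a" using ac unfolding covers_def by blast
  moreover have "c = insert x (c \<inter> {a..})" using above ends by auto
  ultimately show thesis
    using that is_maxchain_upper[OF c ac(1)] ac by blast
qed

section \<open>Roots, and the facets of the order complex\<close>

lemma UNIV_eq_bot_top: "(UNIV :: 'a::{order_bot, order_top} set) = {bot..top}"
  by auto

lemma is_root_insert:
  assumes "is_root x r" "covers x a"
  shows "is_root a (insert a r)"
proof -
  have "is_maxchain {bot..a} (r \<union> {x, a})"
    using is_maxchain_join[OF assms(1)[unfolded is_root_def] is_maxchain_covers[OF assms(2)]]
      assms(2) by (auto simp: covers_def)
  moreover have "x \<in> r" using assms(1) unfolding is_root_def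
    by (auto dest: is_maxchain_interval_ends(2))
  ultimately show ?thesis unfolding is_root_def by (simp add: insert_absorb insert_commute)
qed

lemma is_rootD:
  assumes "is_root x r"
  shows "x \<in> r" "\<And>u. u \<in> r \<Longrightarrow> u \<le> x"
  using assms is_maxchain_interval_ends(2)[of bot x r] is_maxchainD(1)[of "{bot..x}" r]
  unfolding is_root_def by auto

lemma facets_order_complex:
  "facets (order_complex (UNIV :: 'a::{finite, order_bot, order_top} set)) = maximal_chains"
  unfolding facets_def order_complex_def maximal_chains_def pred_on.maxchain_def by auto

section \<open>First atom chains\<close>

text \<open>The first atom chain by recursion on its bottom: passing to the atom \<open>a\<close>
  enlarges the root to \<open>insert a r\<close>, which replaces the indices. The rule
  \<open>step\<close> also governs the last cover, where the indexed definition demands nothing;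
  there the first atom relative to a root is \<open>y\<close> anyway.\<close>

inductive atom_chain :: "('a::order set \<Rightarrow> 'a \<Rightarrow> 'a \<Rightarrow> 'a) \<Rightarrow> 'a set \<Rightarrow> 'a \<Rightarrow> 'a \<Rightarrow> 'a set \<Rightarrow> bool"
  for \<Omega> where
  refl: "atom_chain \<Omega> r x x {x}"
| step: "x < y \<Longrightarrow> a = \<Omega> r x y \<Longrightarrow> atom_chain \<Omega> (insert a r) a y c \<Longrightarrow>
    atom_chain \<Omega> r x y (insert x c)"

lemma atom_chain_lessE:
  assumes "atom_chain \<Omega> r x y c" "x < y"
  obtains c' where "c = insert x c'" "atom_chain \<Omega> (insert (\<Omega> r x y) r) (\<Omega> r x y) y c'"
  using assms by (auto elim: atom_chain.cases)

lemma atom_chain_same: "atom_chain \<Omega> r x x c \<longleftrightarrow> c = {x}"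
  by (auto elim: atom_chain.cases intro: atom_chain.refl)

lemma atom_chain_unique:
  assumes "atom_chain \<Omega> r x y c" "atom_chain \<Omega> r x y d"
  shows "c = d"
  using assms
proof (induction arbitrary: d rule: atom_chain.induct)
  case (refl r x)
  then show ?case by (simp add: atom_chain_same)
next
  case (step x y a r c)
  then show ?case by (metis atom_chain_lessE)
qed

text \<open>The second alternative of \<open>recursive_first_atom_set\<close>, with \<open>b\<close>
  replaced by its value. Posets of length 1 are treated separately.\<close>

locale first_atom_set =
  fixes \<Omega> :: "'a::{finite, order_bot, order_top} set \<Rightarrow> 'a \<Rightarrow> 'a \<Rightarrow> 'a"
  assumes atom: "x < y \<Longrightarrow> is_root x r \<Longrightarrow> is_atom x y (\<Omega> r x y)"
    and first_iff: "x < y \<Longrightarrow> is_root x r \<Longrightarrow> is_atom x y a \<Longrightarrow> a < y \<Longrightarrow>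
      a = \<Omega> r x y \<longleftrightarrow> a = \<Omega> r x (\<Omega> (insert a r) a y)"
    and path: "x < y \<Longrightarrow> is_root x r \<Longrightarrow> is_atom x y a \<Longrightarrow> a < y \<Longrightarrow> a \<noteq> \<Omega> r x y \<Longrightarrow>
      \<exists>p as bs. 1 \<le> (p::nat) \<and> (\<forall>i \<in> {1..p}. is_atom x y (as i)) \<and>
        as p = \<Omega> r x (\<Omega> (insert a r) a y) \<and> as 1 = \<Omega> r x y \<and>
        (\<forall>i. 1 \<le> i \<and> i < p \<longrightarrow>
          bs i = \<Omega> (insert (as (i + 1)) r) (as (i + 1)) y \<and> as i = \<Omega> r x (bs i))"
begin

lemma first_atom_covers:
  assumes "x < y" "is_root x r"
  shows "covers x (\<Omega> r x y)" "\<Omega> r x y \<le> y" "x < \<Omega> r x y"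
  using atom[OF assms] unfolding is_atom_def covers_def by auto

lemma first_atom_of_cover:
  assumes "covers x y" "is_root x r"
  shows "\<Omega> r x y = y"
proof -
  have "x < y" using assms(1) by (simp add: covers_def)
  then show ?thesis
    using covers_le_cases[OF assms(1), of "\<Omega> r x y"] first_atom_covers[OF _ assms(2)] by force
qed

text \<open>The number of elements weakly above \<open>x\<close> drops on passing to an atom; later
  inductions along a chain use the same measure.\<close>

lemma atom_chain_exists:
  assumes "x \<le> y" "is_root x r"
  shows "\<exists>c. atom_chain \<Omega> r x y c"
  using assms
proof (induction "card {x..}" arbitrary: x r rule: less_induct)
  case less
  show ?case
  proof (cases "x = y")
    case True
    then show ?thesis by (auto simp: atom_chain_same)
  next
    case False
    then have "x < y" using less.prems by simp
    note fa = first_atom_covers[OF this less.prems(2)]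
    have "card {\<Omega> r x y..} < card {x..}"
      using fa(3) by (intro psubset_card_mono) auto
    from less.hyps[OF this fa(2) is_root_insert[OF less.prems(2) fa(1)]]
    show ?thesis using atom_chain.step[OF \<open>x < y\<close> HOL.refl] by blast
  qed
qed

lemma atom_chain_maxchain:
  assumes "atom_chain \<Omega> r x y c" "is_root x r"
  shows "x \<le> y" "is_maxchain {x..y} c"
proof -
  have "x \<le> y \<and> is_maxchain {x..y} c"
    using assms
  proof (induction rule: atom_chain.induct)
    case (refl r x)
    then show ?case by (simp add: is_maxchain_singleton)
  next
    case (step x y a r c)
    note fa = first_atom_covers[OF step.hyps(1) step.prems, folded step.hyps(2)]
    have c: "is_maxchain {a..y} c"
      using step.IH is_root_insert[OF step.prems fa(1)] by blast
    have "is_maxchain {x..y} ({x, a} \<union> c)"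
      using is_maxchain_join[OF is_maxchain_covers[OF fa(1)] c] fa by auto
    moreover have "a \<in> c" using is_maxchain_interval_ends(1)[OF c fa(2)] .
    ultimately show ?case using step.hyps(1) by (simp add: insert_absorb)
  qed
  then show "x \<le> y" "is_maxchain {x..y} c" by auto
qed

text \<open>Prepending \<open>x\<close> shifts the sequence by one: the atom \<open>a\<close>, part
  of the root of the tail, becomes the entry with index 1.\<close>

lemma atom_chain_is_first_atom_chain:
  assumes "atom_chain \<Omega> r x y c" "is_root x r"
  shows "is_first_atom_chain \<Omega> r x y c"
  using assms
proof (induction rule: atom_chain.induct)
  case (refl r x)
  show ?case unfolding is_first_atom_chain_def
    by (intro exI[of _ 0] exI[of _ "\<lambda>_. x"]) auto
next
  case (step x y a r c)
  note fa = first_atom_covers[OF step.hyps(1) step.prems, folded step.hyps(2)]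
  obtain q z where z: "c = z ` {0..(q::nat)}" "z 0 = a" "z q = y"
    "\<And>i. i < q \<Longrightarrow> covers (z i) (z (i + 1))"
    "\<And>i. i + 2 \<le> q \<Longrightarrow> z (i + 1) = \<Omega> (insert a r \<union> z ` {1..i}) (z i) y"
    using step.IH[OF is_root_insert[OF step.prems fa(1)]]
    unfolding is_first_atom_chain_def by blast
  define z' where "z' = case_nat x z"
  have z'0: "z' 0 = x" and z'S: "\<And>i. z' (Suc i) = z i" unfolding z'_def by auto
  have img: "z' ` {Suc i..Suc j} = z ` {i..j}" for i j
    unfolding image_Suc_atLeastAtMost[symmetric] image_image z'S ..
  have "insert x c = z' ` {0..Suc q}"
  proof -
    have "{0..Suc q} = insert 0 {Suc 0..Suc q}" by auto
    then show ?thesis using z'0 img[of 0 q] z(1) by simp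
  qed
  moreover have "covers (z' i) (z' (i + 1))" if "i < Suc q" for i
    using that z(2,4) fa(1) z'0 z'S by (cases i) auto
  moreover have "z' (i + 1) = \<Omega> (r \<union> z' ` {1..i}) (z' i) y" if "i + 2 \<le> Suc q" for i
  proof (cases i)
    case 0
    then show ?thesis using z'0 z'S[of 0] z(2) step.hyps(2) by simp
  next
    case (Suc j)
    have "{0..j} = insert 0 {1..j}" by auto
    then have "r \<union> z' ` {1..i} = insert a r \<union> z ` {1..j}"
      using img[of 0 j] z(2) Suc by auto
    then show ?thesis using z(5)[of j] that Suc z'S by auto
  qed
  ultimately show ?case unfolding is_first_atom_chain_def
    using z'0 z'S[of q] z(3) by blast
qed

text \<open>This converse makes the description by \<open>THE\<close> usable, since uniqueness of
  the inductive chain carries over to the indexed definition.\<close>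

lemma is_first_atom_chain_atom_chain:
  assumes "is_first_atom_chain \<Omega> r x y c" "is_root x r"
  shows "atom_chain \<Omega> r x y c"
proof -
  have "atom_chain \<Omega> r x y (z ` {0..q})"
    if "z 0 = x" "z q = y" "\<And>i. i < q \<Longrightarrow> covers (z i) (z (i + 1))"
      "\<And>i. i + 2 \<le> q \<Longrightarrow> z (i + 1) = \<Omega> (r \<union> z ` {1..i}) (z i) y" "is_root x r"
    for q :: nat and z
    using that
  proof (induction q arbitrary: r x z)
    case 0
    then show ?case by (simp add: atom_chain.refl)
  next
    case (Suc q)
    define z' where "z' = (\<lambda>i. z (Suc i))"
    have cov: "covers x (z 1)" using Suc.prems(1) Suc.prems(3)[of 0] by simp
    note root = is_root_insert[OF Suc.prems(5) cov]
    have "z' (i + 1) = \<Omega> (insert (z 1) r \<union> z' ` {1..i}) (z' i) y" if "i + 2 \<le> q" for i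
    proof -
      have "{1..i + 1} = insert 1 (Suc ` {1..i})"
        unfolding image_Suc_atLeastAtMost by auto
      then have "z ` {1..i + 1} = insert (z 1) (z' ` {1..i})"
        unfolding z'_def by (simp only: image_insert image_image)
      then have "r \<union> z ` {1..i + 1} = insert (z 1) r \<union> z' ` {1..i}" by simp
      then show ?thesis using Suc.prems(4)[of "i + 1"] that unfolding z'_def by simp
    qed
    then have ch: "atom_chain \<Omega> (insert (z 1) r) (z 1) y (z' ` {0..q})"
      using Suc.prems(2,3) root by (intro Suc.IH) (auto simp: z'_def)
    have le: "z 1 \<le> y" using atom_chain_maxchain(1)[OF ch root] .
    then have "x < y" using cov by (auto simp: covers_def)
    \<comment> \<open>If \<open>q = 0\<close>, the whole sequence is one cover, which the definition
      leaves unconstrained; then \<open>y\<close> is the only atom available.\<close>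
    have "z 1 = \<Omega> r x y"
    proof (cases q)
      case 0
      then have "z 1 = y" using Suc.prems(2) by simp
      then show ?thesis using first_atom_of_cover[OF _ Suc.prems(5)] cov by simp
    next
      case (Suc k)
      then show ?thesis using Suc.prems(1) Suc.prems(4)[of 0] by simp
    qed
    moreover have "z ` {0..Suc q} = insert x (z' ` {0..q})"
    proof -
      have "{0..Suc q} = insert 0 (Suc ` {0..q})"
        unfolding image_Suc_atLeastAtMost by auto
      then show ?thesis using Suc.prems(1) unfolding z'_def by (simp only: image_insert image_image)
    qed
    ultimately show ?case using atom_chain.step[where \<Omega> = \<Omega>, OF \<open>x < y\<close> _ ch] by simp
  qed
  then show ?thesis using assms unfolding is_first_atom_chain_def by blast
qed

lemma first_atom_chain_eq:
  assumes "atom_chain \<Omega> r x y c" "is_root x r"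
  shows "first_atom_chain \<Omega> r x y = c"
  unfolding first_atom_chain_def
proof (rule the_equality)
  show "is_first_atom_chain \<Omega> r x y c" using atom_chain_is_first_atom_chain[OF assms] .
  show "d = c" if "is_first_atom_chain \<Omega> r x y d" for d
    using atom_chain_unique[OF is_first_atom_chain_atom_chain[OF that assms(2)] assms(1)] .
qed

text \<open>The local conditions combine from the top down. Once the part above the atom
  \<open>a\<close> is a first atom chain, its next element is
  \<open>b = \<Omega> (insert a r) a y\<close>; the condition at \<open>x\<close>, \<open>a\<close>,
  \<open>b\<close> gives \<open>a = \<Omega> r x b\<close>, and \<open>first_iff\<close> turns
  \<open>b\<close> into \<open>y\<close>. The set \<open>r \<union> c \<inter> {..u}\<close> is the
  root of \<open>u\<close> along the chain.\<close>

lemma no_pseudo_descent_atom_chain: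
  assumes "x \<le> y" "is_root x r" "is_maxchain {x..y} c"
    and "\<And>u v w. {u, v, w} \<subseteq> c \<Longrightarrow> covers u v \<Longrightarrow> covers v w \<Longrightarrow> v = \<Omega> (r \<union> c \<inter> {..u}) u w"
  shows "atom_chain \<Omega> r x y c"
  using assms
proof (induction "card {x..}" arbitrary: x r c rule: less_induct)
  case less
  show ?case
  proof (cases "x = y")
    case True
    then show ?thesis using less.prems(3) by (simp add: atom_chain_same is_maxchain_singleton)
  next
    case False
    then have "x < y" using less.prems by simp
    from is_maxchain_first_step[OF less.prems(3) this]
    obtain a c' where a: "covers x a" "a \<le> y" and c': "is_maxchain {a..y} c'" "c = insert x c'"
      and "a \<in> c'" by blast
    have "x < a" using a by (simp add: covers_def)
    then have card: "card {a..} < card {x..}" by (intro psubset_card_mono) auto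
    have above: "a \<le> u" if "u \<in> c'" for u using is_maxchainD(1)[OF c'(1)] that by auto
    have xr: "x \<in> r" using is_rootD[OF less.prems(2)] by simp
    note root = is_root_insert[OF less.prems(2) a(1)]
    have ch: "atom_chain \<Omega> (insert a r) a y c'"
    proof (rule less.hyps[OF card a(2) root c'(1)])
      fix u v w assume uvw: "{u, v, w} \<subseteq> c'" "covers u v" "covers v w"
      have "insert a r \<union> c' \<inter> {..u} = r \<union> c \<inter> {..u}"
        using xr c'(2) above[of u] \<open>a \<in> c'\<close> uvw(1) by auto
      then show "v = \<Omega> (insert a r \<union> c' \<inter> {..u}) u w"
        using less.prems(4)[of u v w] uvw c'(2) by auto
    qed
    have "a = \<Omega> r x y"
    proof (cases "a = y")
      case True
      then show ?thesis using first_atom_of_cover[OF _ less.prems(2)] a by simp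
    next
      case False
      then have "a < y" using a(2) by simp
      define b where "b = \<Omega> (insert a r) a y"
      note fb = first_atom_covers[OF \<open>a < y\<close> root, folded b_def]
      obtain c'' where c'': "c' = insert a c''" "atom_chain \<Omega> (insert b (insert a r)) b y c''"
        using atom_chain_lessE[OF ch \<open>a < y\<close>] unfolding b_def by blast
      have "b \<in> c''"
        using is_maxchain_interval_ends(1) atom_chain_maxchain[OF c''(2) is_root_insert[OF root fb(1)]]
        by blast
      moreover have "r \<union> c \<inter> {..x} = r"
        using xr c'(2) above \<open>x < a\<close> by force
      ultimately have "a = \<Omega> r x b"
        using less.prems(4)[of x a b] c'(2) c''(1) a(1) fb(1) by auto
      then show ?thesis
        using first_iff[OF \<open>x < y\<close> less.prems(2) _ \<open>a < y\<close>] a \<open>x < a\<close>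
        unfolding b_def is_atom_def by auto
    qed
    then show ?thesis
      using atom_chain.step[where \<Omega> = \<Omega>, OF \<open>x < y\<close> _ ch] c'(2) by simp
  qed
qed

section \<open>The order on maximal chains\<close>

lemma maximal_chain_join:
  assumes "is_root x r" "is_maxchain {x..y} c" "is_maxchain {y..top} t" "x \<le> y"
  shows "r \<union> c \<union> t \<in> maximal_chains"
proof -
  have "is_maxchain {bot..y} (r \<union> c)"
    using is_maxchain_join[OF assms(1)[unfolded is_root_def] assms(2)] assms(4) by simp
  from is_maxchain_join[OF this assms(3)] show ?thesis
    unfolding maximal_chains_def UNIV_eq_bot_top by simp
qed

text \<open>Both chains share \<open>r\<close> and \<open>t\<close>; only the element
  \<open>a\<close> gives way to the interior of \<open>d\<close>, which may be longer. This serves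
  the walk between atoms as well as the final exchange.\<close>

lemma chain_step_replace:
  assumes r: "is_root x r" and xa: "covers x a" and ab: "covers a b" and ne: "a \<noteq> \<Omega> r x b"
    and d: "atom_chain \<Omega> r x b d" and t: "is_maxchain {b..top} t"
  shows "chain_step \<Omega> (r \<union> d \<union> t) (insert a (r \<union> t))"
proof -
  have lt: "x < a" "a < b" using xa ab by (auto simp: covers_def)
  then have "x < b" by simp
  have dm: "is_maxchain {x..b} d" using atom_chain_maxchain[OF d r] by simp
  have dx: "x \<in> d" "b \<in> d" "\<And>u. u \<in> d \<Longrightarrow> x \<le> u \<and> u \<le> b"
    using is_maxchain_interval_ends[OF dm] is_maxchainD(1)[OF dm] \<open>x < b\<close> by auto
  have tx: "b \<in> t" "\<And>u. u \<in> t \<Longrightarrow> b \<le> u"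
    using is_maxchain_interval_ends[OF t] is_maxchainD(1)[OF t] by auto
  note rx = is_rootD[OF r]
  have "is_maxchain {a..top} ({a, b} \<union> t)"
    using is_maxchain_join[OF is_maxchain_covers[OF ab] t] lt by auto
  then have "is_maxchain {a..top} (insert a t)" using tx(1) by (simp add: insert_absorb)
  from maximal_chain_join[OF r is_maxchain_covers[OF xa] this]
  have m': "insert a (r \<union> t) \<in> maximal_chains" using lt rx(1) by (simp add: insert_absorb insert_commute)
  have m: "r \<union> d \<union> t \<in> maximal_chains" using maximal_chain_join[OF r dm t] \<open>x < b\<close> by simp
  have nx: "\<not> u \<le> x" if "u \<in> t" for u using tx(2)[OF that] \<open>x < b\<close> by (auto dest: order.trans)
  have nb: "\<not> b \<le> u" if "u \<in> r" for u using rx(2)[OF that] \<open>x < b\<close> by (auto dest: order.trans)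
  have below: "below (r \<union> d \<union> t) x = r" "below (insert a (r \<union> t)) x = r"
    unfolding below_def using rx nx dx lt by (auto dest: order.antisym)
  have upper: "{w \<in> r \<union> d \<union> t. b \<le> w} = t" "{w \<in> insert a (r \<union> t). b \<le> w} = t"
    using tx nb dx lt by (auto dest: order.antisym)
  have "r \<inter> {x..} \<subseteq> {x}" "t \<inter> {..b} \<subseteq> {b}"
    using rx tx by (auto intro: order.antisym)
  then have mid: "(r \<union> d \<union> t) \<inter> {x..b} = d"
    using dx by fastforce
  have "pseudo_descent \<Omega> (insert a (r \<union> t)) x a b"
    unfolding pseudo_descent_def below using rx tx xa ab ne by auto
  moreover have "{x, b} \<subseteq> (r \<union> d \<union> t) \<inter> insert a (r \<union> t)" using rx(1) tx(1) by simp
  ultimately show ?thesis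
    unfolding chain_step_def
    using m m' xa ab below upper mid first_atom_chain_eq[OF d r]
    by (intro conjI exI[of _ x] exI[of _ a] exI[of _ b]) simp_all
qed

text \<open>The root \<open>r\<close> grows in the induction while the tail \<open>t\<close> stays
  fixed, so that all comparisons concern maximal chains of the whole poset.\<close>

lemma atom_chain_minimal:
  assumes "x \<le> y" "is_root x r" "is_maxchain {x..y} c" "is_maxchain {y..top} t"
    "atom_chain \<Omega> r x y d"
  shows "chain_le \<Omega> (r \<union> d \<union> t) (r \<union> c \<union> t)"
  using assms
proof (induction "card {x..}" arbitrary: x r c d rule: less_induct)
  case less
  note t = \<open>is_maxchain {y..top} t\<close> and r = less.prems(2)
  have trans: "chain_le \<Omega> k m" if "chain_le \<Omega> k l" "chain_le \<Omega> l m" for k l m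
    using that unfolding chain_le_def by (rule rtranclp_trans)
  have xr: "x \<in> r" using is_rootD[OF r] by simp
  show ?case
  proof (cases "x = y")
    case True
    then show ?thesis using less.prems(3,5)
      by (simp add: atom_chain_same is_maxchain_singleton chain_le_def)
  next
    case False
    then have "x < y" using less.prems by simp
    \<comment> \<open>\<open>M a\<close> follows \<open>r\<close>, goes to the atom
      \<open>a\<close>, continues along the first atom chain to \<open>y\<close>, and ends with
      \<open>t\<close>. First atom chains are unique, so \<open>SOME\<close> makes no real choice at
      an atom.\<close>
    define E where "E = (\<lambda>a. SOME e. atom_chain \<Omega> (insert a r) a y e)"
    define M where "M = (\<lambda>a. insert a r \<union> E a \<union> t)"
    have E: "atom_chain \<Omega> (insert a r) a y (E a)" if "is_atom x y a" for a
      using someI_ex[OF atom_chain_exists[of a y "insert a r"]] that is_root_insert[OF r]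
      unfolding E_def is_atom_def by auto
    \<comment> \<open>The induction hypothesis at \<open>a\<close>: \<open>M a\<close> is least
      among the chains that extend \<open>insert a r\<close> and end with \<open>t\<close>.\<close>
    have straighten: "chain_le \<Omega> (M a) (insert a r \<union> e \<union> t)"
      if a: "is_atom x y a" and e: "is_maxchain {a..y} e" for a e
    proof -
      have xa: "covers x a" "a \<le> y" "x < a" using a unfolding is_atom_def covers_def by auto
      then have "card {a..} < card {x..}" by (intro psubset_card_mono) auto
      from less.hyps[OF this xa(2) is_root_insert[OF r xa(1)] e t E[OF a]]
      show ?thesis unfolding M_def .
    qed
    \<comment> \<open>One move of the walk. Replacing \<open>a\<close> by the first atom chain from
      \<open>x\<close> to \<open>b\<close> leads through the atom \<open>\<Omega> r x b\<close>;
      above that atom the result need not be a first atom chain up to \<open>y\<close>, so it is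
      straightened once more.\<close>
    have down: "chain_le \<Omega> (M (\<Omega> r x b)) (M a)"
      if a: "is_atom x y a" "a < y" and b: "b = \<Omega> (insert a r) a y" for a b
    proof (cases "a = \<Omega> r x b")
      case True
      then show ?thesis by (simp add: chain_le_def)
    next
      case False
      have xa: "covers x a" "x < a" using a unfolding is_atom_def covers_def by auto
      note root = is_root_insert[OF r xa(1)]
      note fb = first_atom_covers[OF a(2) root, folded b]
      then have "x < b" using xa by simp
      note fa = first_atom_covers[OF this r]
      note root' = is_root_insert[OF r fa(1)]
      define a' where "a' = \<Omega> r x b"
      obtain e where e: "E a = insert a e" "atom_chain \<Omega> (insert b (insert a r)) b y e"
        using atom_chain_lessE[OF E[OF a(1)] a(2)] unfolding b by blast
      have em: "is_maxchain {b..y} e"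
        using atom_chain_maxchain[OF e(2) is_root_insert[OF root fb(1)]] by simp
      obtain d' where d': "atom_chain \<Omega> r x b d'"
        using atom_chain_exists[OF _ r] \<open>x < b\<close> by (meson less_imp_le)
      obtain f where f: "d' = insert x f" "atom_chain \<Omega> (insert a' r) a' b f"
        using atom_chain_lessE[OF d' \<open>x < b\<close>] unfolding a'_def by blast
      have fm: "is_maxchain {a'..b} f"
        using atom_chain_maxchain[OF f(2)] root' unfolding a'_def by simp
      have af: "a' \<in> f" using is_maxchain_interval_ends(1)[OF fm] fa unfolding a'_def by simp
      have et: "is_maxchain {b..top} (e \<union> t)"
        using is_maxchain_join[OF em t fb(2)] by simp
      have "chain_step \<Omega> (r \<union> d' \<union> (e \<union> t)) (insert a (r \<union> (e \<union> t)))"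
        by (rule chain_step_replace[OF r xa(1) fb(1) False d' et])
      then have "chain_le \<Omega> (insert a' r \<union> (f \<union> e) \<union> t) (M a)"
        using xr af f(1) e(1) unfolding M_def chain_le_def
        by (auto simp: insert_absorb Un_ac insert_commute)
      moreover have "chain_le \<Omega> (M a') (insert a' r \<union> (f \<union> e) \<union> t)"
      proof (rule straighten)
        show "is_atom x y a'"
          using fa fb unfolding a'_def is_atom_def by (auto simp: less_imp_le)
        show "is_maxchain {a'..y} (f \<union> e)"
          using is_maxchain_join[OF fm em] fa fb unfolding a'_def by simp
      qed
      ultimately show ?thesis using trans unfolding a'_def by blast
    qed
    from is_maxchain_first_step[OF less.prems(3) \<open>x < y\<close>]
    obtain a c' where a: "covers x a" "a \<le> y" and c': "is_maxchain {a..y} c'" "c = insert x c'"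
      and "a \<in> c'" by blast
    have atom_a: "is_atom x y a" using a unfolding is_atom_def covers_def by auto
    have Mc: "chain_le \<Omega> (M a) (r \<union> c \<union> t)"
      using straighten[OF atom_a c'(1)] c'(2) xr \<open>a \<in> c'\<close>
      by (simp add: insert_absorb)
    have Md: "M (\<Omega> r x y) = r \<union> d \<union> t"
    proof -
      obtain e where e: "d = insert x e" "atom_chain \<Omega> (insert (\<Omega> r x y) r) (\<Omega> r x y) y e"
        using atom_chain_lessE[OF less.prems(5) \<open>x < y\<close>] by blast
      have "E (\<Omega> r x y) = e"
        using atom_chain_unique[OF E[OF atom[OF \<open>x < y\<close> r]] e(2)] .
      moreover have "\<Omega> r x y \<in> e"
        using atom_chain_maxchain[OF e(2) is_root_insert[OF r first_atom_covers(1)[OF \<open>x < y\<close> r]]]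
          is_maxchain_interval_ends(1) by blast
      ultimately show ?thesis unfolding M_def e(1) using xr by (auto simp: insert_absorb)
    qed
    show ?thesis
    proof (cases "a = \<Omega> r x y")
      case True
      then show ?thesis using Mc Md by simp
    next
      case False
      \<comment> \<open>Otherwise \<open>y\<close> would cover \<open>x\<close> and be the first
        atom itself.\<close>
      then have "a \<noteq> y" using first_atom_of_cover[OF _ r] a(1) by auto
      then have "a < y" using a(2) by simp
      obtain p as bs where p: "1 \<le> (p::nat)" "\<And>i. i \<in> {1..p} \<Longrightarrow> is_atom x y (as i)"
        "as p = \<Omega> r x (\<Omega> (insert a r) a y)" "as 1 = \<Omega> r x y"
        "\<And>i. 1 \<le> i \<Longrightarrow> i < p \<Longrightarrow>
          bs i = \<Omega> (insert (as (i + 1)) r) (as (i + 1)) y \<and> as i = \<Omega> r x (bs i)"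
        using path[OF \<open>x < y\<close> r atom_a \<open>a < y\<close> False] by blast
      \<comment> \<open>By \<open>path\<close>, \<open>down\<close> applied at
        \<open>as (i + 1)\<close> arrives at \<open>\<Omega> r x (bs i) = as i\<close>, so the walk
        ends at \<open>as 1\<close>, the first atom of the whole interval.\<close>
      have "chain_le \<Omega> (M (as 1)) (M (as i))" if "1 \<le> i" "i \<le> p" for i
        using that
      proof (induction i rule: dec_induct)
        case base
        show ?case by (simp add: chain_le_def)
      next
        case (step i)
        have at: "is_atom x y (as (i + 1))" using p(2) step.prems by simp
        \<comment> \<open>The element \<open>a\<close> lies strictly between \<open>x\<close> and
          \<open>y\<close>, so \<open>y\<close> is not an atom.\<close>
        have "as (i + 1) \<noteq> y"
          using at a(1) \<open>a < y\<close> unfolding is_atom_def covers_def by auto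
        then have "as (i + 1) < y" using at unfolding is_atom_def by auto
        from down[OF at this HOL.refl] have "chain_le \<Omega> (M (as i)) (M (as (i + 1)))"
          using p(5)[of i] step.hyps step.prems by auto
        then show ?case using step.IH step.prems trans by simp
      qed
      then have "chain_le \<Omega> (M (as 1)) (M (as p))" using p(1) by simp
      moreover have "chain_le \<Omega> (M (as p)) (M a)"
        using down[OF atom_a \<open>a < y\<close> HOL.refl] p(3) by simp
      ultimately show ?thesis using Mc Md p(4) trans by metis
    qed
  qed
qed

text \<open>Induction on the number of elements of \<open>m'\<close> missing from \<open>m\<close>,
  filling the lowest gap first.\<close>

lemma chain_le_if_no_pseudo_descent:
  assumes "m \<in> maximal_chains" "m' \<in> maximal_chains"
    and "\<And>u v w. pseudo_descent \<Omega> m' u v w \<Longrightarrow> v \<in> m"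
  shows "chain_le \<Omega> m' m"
  using assms
proof (induction "card (m' - m)" arbitrary: m rule: less_induct)
  case less
  have m: "is_maxchain {bot..top} m" and m': "is_maxchain {bot..top} m'"
    using less.prems unfolding maximal_chains_def UNIV_eq_bot_top by auto
  note cmp' = is_maxchainD(2)[OF m']
  show ?case
  proof (cases "m' \<subseteq> m")
    case True
    have "m = m'"
      using is_maxchainD(3)[OF m'] is_maxchainD(2)[OF m] True by auto
    then show ?thesis by (simp add: chain_le_def)
  next
    case False
    then have "finite (m' - m)" "m' - m \<noteq> {}" by auto
    \<comment> \<open>By minimality of \<open>v\<close>, everything of \<open>m'\<close> below it
      lies in \<open>m\<close>. The gap is bounded by \<open>x\<close> and \<open>y\<close>, the
      common elements nearest to \<open>v\<close> on either side.\<close>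
    then obtain v where v: "v \<in> m'" "v \<notin> m" and vmin: "\<forall>w\<in>m' - m. w \<le> v \<longrightarrow> v = w"
      using finite_has_minimal by (metis DiffE)
    define X where "X = {w \<in> m \<inter> m'. w < v}"
    define Y where "Y = {w \<in> m \<inter> m'. v < w}"
    have ends: "bot \<in> m" "bot \<in> m'" "top \<in> m" "top \<in> m'"
      using is_maxchain_interval_ends[OF m] is_maxchain_interval_ends[OF m'] by auto
    have "bot < v" "v < top"
      using v ends by (auto simp: bot.not_eq_extremum[symmetric] top.not_eq_extremum[symmetric])
    then have "X \<noteq> {}" "Y \<noteq> {}" unfolding X_def Y_def using ends by auto
    then obtain x y where x: "x \<in> X" "\<forall>w\<in>X. x \<le> w \<longrightarrow> x = w"
      and y: "y \<in> Y" "\<forall>w\<in>Y. w \<le> y \<longrightarrow> y = w"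
      using finite_has_maximal[of X] finite_has_minimal[of Y] by (metis finite)
    have xm: "x \<in> m" "x \<in> m'" "x < v" and ym: "y \<in> m" "y \<in> m'" "v < y"
      using x(1) y(1) unfolding X_def Y_def by auto
    have "x < y" using xm ym by simp
    have xmax: "w \<le> x" if "w \<in> m" "w \<in> m'" "w < v" for w
      using x(2) cmp'[of x w] xm that unfolding X_def by auto
    have ymin: "y \<le> w" if "w \<in> m" "w \<in> m'" "v < w" for w
      using y(2) cmp'[of y w] ym that unfolding Y_def by auto
    have gap: "w \<le> x \<or> y \<le> w" if "w \<in> m" "w \<in> m'" for w
      using xmax[OF that] ymin[OF that] cmp'[of v w] v that by (auto simp: order.order_iff_strict)
    define r where "r = m \<inter> {..x}"
    define c where "c = m \<inter> {x..} \<inter> {..y}"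
    define t where "t = m \<inter> {y..}"
    define d where "d = m' \<inter> {x..} \<inter> {..y}"
    have root: "is_root x r" unfolding is_root_def r_def using is_maxchain_lower[OF m xm(1)] .
    have cm: "is_maxchain {x..y} c"
      using is_maxchain_lower[OF is_maxchain_upper[OF m xm(1)]] ym \<open>x < y\<close> unfolding c_def by auto
    have dm: "is_maxchain {x..y} d"
      using is_maxchain_lower[OF is_maxchain_upper[OF m' xm(2)]] ym \<open>x < y\<close> unfolding d_def by auto
    have tm: "is_maxchain {y..top} t"
      using is_maxchain_upper[OF m ym(1)] unfolding t_def .
    have sub: "m' \<inter> {..x} \<subseteq> r"
    proof
      fix w assume w: "w \<in> m' \<inter> {..x}"
      then have "w < v" using xm(3) by auto
      then have "w \<in> m" using vmin w by (auto simp: less_le)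
      then show "w \<in> r" using w unfolding r_def by simp
    qed
    \<comment> \<open>\<open>\<Omega>\<close> depends on the root, so information on pseudo descents
      of \<open>m'\<close> transfers to the gap of \<open>m\<close> only because both chains agree
      below \<open>x\<close>.\<close>
    have r_eq: "r = m' \<inter> {..x}"
    proof
      show "m' \<inter> {..x} \<subseteq> r" by (rule sub)
      have mx: "is_maxchain {bot..x} (m' \<inter> {..x})" using is_maxchain_lower[OF m' xm(2)] .
      show "r \<subseteq> m' \<inter> {..x}"
        using is_maxchainD(3)[OF mx] is_maxchainD(2)[OF m] sub unfolding r_def by auto
    qed
    have m_eq: "m = r \<union> c \<union> t"
      using is_maxchainD(2)[OF m] xm(1) ym(1) unfolding r_def c_def t_def by auto
    have "atom_chain \<Omega> r x y d"
    proof (rule no_pseudo_descent_atom_chain[OF _ root dm])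
      show "x \<le> y" using \<open>x < y\<close> by simp
      fix u w z assume u: "{u, w, z} \<subseteq> d" and cov: "covers u w" "covers w z"
      have "u < w" "w < z" using cov by (auto simp: covers_def)
      moreover have "x \<le> u" "z \<le> y" using u unfolding d_def by auto
      ultimately have "x < w" "w < y" by auto
      \<comment> \<open>Strictly inside the gap the chains share nothing, so by assumption
        \<open>w\<close> is not the middle of a pseudo descent.\<close>
      then have "w \<notin> m" using gap[of w] u unfolding d_def by auto
      moreover have "below m' u = r \<union> d \<inter> {..u}"
      proof -
        have "m' \<inter> {..u} = (m' \<inter> {..x}) \<union> (d \<inter> {..u})"
          using cmp' xm(2) \<open>x \<le> u\<close> u unfolding d_def by (auto intro: order.trans)
        then show ?thesis unfolding r_eq below_def by auto
      qed
      ultimately show "w = \<Omega> (r \<union> d \<inter> {..u}) u z"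
        using less.prems(3)[of u w z] u cov unfolding pseudo_descent_def d_def by auto
    qed
    then have le: "chain_le \<Omega> (r \<union> d \<union> t) m"
      using atom_chain_minimal[OF _ root cm tm] \<open>x < y\<close> m_eq by simp
    \<comment> \<open>No common element is lost, so the assumption on pseudo descents survives for
      the new chain; it gains \<open>v\<close>, so the measure drops.\<close>
    have keep: "m \<inter> m' \<subseteq> r \<union> d \<union> t" using gap unfolding r_def t_def by auto
    have "v \<in> d" using v xm ym unfolding d_def by auto
    then have "m' - (r \<union> d \<union> t) \<subset> m' - m" using v keep by auto
    then have "card (m' - (r \<union> d \<union> t)) < card (m' - m)" by (intro psubset_card_mono) auto
    moreover have "r \<union> d \<union> t \<in> maximal_chains"
      using maximal_chain_join[OF root dm tm] \<open>x < y\<close> by simp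
    moreover have "w \<in> r \<union> d \<union> t" if "pseudo_descent \<Omega> m' u w z" for u w z
      using less.prems(3)[OF that] that keep unfolding pseudo_descent_def by auto
    ultimately have "chain_le \<Omega> m' (r \<union> d \<union> t)" using less.hyps less.prems(2) by blast
    then show ?thesis using le unfolding chain_le_def by (rule rtranclp_trans)
  qed
qed

text \<open>Supplies the facet that shares with \<open>m'\<close> the codimension one face
  \<open>m' - {v}\<close>.\<close>

lemma pseudo_descent_chain_step:
  assumes m': "m' \<in> maximal_chains" and pd: "pseudo_descent \<Omega> m' x v z"
  shows "\<exists>k. chain_step \<Omega> k m' \<and> m' - {v} \<subseteq> k \<and> v \<notin> k"
proof -
  have mc: "is_maxchain {bot..top} m'"
    using m' unfolding maximal_chains_def UNIV_eq_bot_top by auto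
  have in_m: "x \<in> m'" "v \<in> m'" "z \<in> m'" and cov: "covers x v" "covers v z"
    and ne: "v \<noteq> \<Omega> (below m' x) x z"
    using pd unfolding pseudo_descent_def by auto
  have lt: "x < v" "v < z" using cov by (auto simp: covers_def)
  then have "x < z" by simp
  have bel: "below m' x = m' \<inter> {..x}" unfolding below_def by auto
  have root: "is_root x (below m' x)"
    unfolding is_root_def bel using is_maxchain_lower[OF mc in_m(1)] .
  define t where "t = m' \<inter> {z..}"
  have t: "is_maxchain {z..top} t" unfolding t_def using is_maxchain_upper[OF mc in_m(3)] .
  obtain d where d: "atom_chain \<Omega> (below m' x) x z d"
    using atom_chain_exists[OF _ root] \<open>x < z\<close> by (meson less_imp_le)
  have eq: "insert v (below m' x \<union> t) = m'"
  proof -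
    have "w \<le> x \<or> w = v \<or> z \<le> w" if w: "w \<in> m'" for w
      using is_maxchainD(2)[OF mc w in_m(1)] is_maxchainD(2)[OF mc w in_m(2)]
        is_maxchainD(2)[OF mc w in_m(3)] covers_le_cases[OF cov(1), of w]
        covers_le_cases[OF cov(2), of w] by auto
    then show ?thesis unfolding bel t_def using in_m by auto
  qed
  \<comment> \<open>Apart from \<open>x\<close>, all of \<open>d\<close> lies weakly above the first
    atom. If \<open>v\<close> were in \<open>d\<close>, that atom would be at most \<open>v\<close>,
    hence equal to \<open>v\<close> because \<open>v\<close> covers \<open>x\<close>, contrary to
    the pseudo descent.\<close>
  have "v \<notin> d"
  proof
    assume "v \<in> d"
    note fa = first_atom_covers[OF \<open>x < z\<close> root]
    obtain e where e: "d = insert x e"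
      "atom_chain \<Omega> (insert (\<Omega> (below m' x) x z) (below m' x)) (\<Omega> (below m' x) x z) z e"
      using atom_chain_lessE[OF d \<open>x < z\<close>] by blast
    have "is_maxchain {\<Omega> (below m' x) x z..z} e"
      using atom_chain_maxchain(2)[OF e(2) is_root_insert[OF root fa(1)]] .
    then have "\<Omega> (below m' x) x z \<le> v"
      using is_maxchainD(1) \<open>v \<in> d\<close> e(1) lt by fastforce
    then show False using covers_le_cases[OF cov(1), of "\<Omega> (below m' x) x z"] fa ne
      by (simp add: less_le)
  qed
  moreover have "v \<notin> below m' x" "v \<notin> t" using lt unfolding bel t_def by auto
  moreover have "chain_step \<Omega> (below m' x \<union> d \<union> t) m'"
    using chain_step_replace[OF root cov ne d t] eq by simp
  ultimately show ?thesis using eq by blast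
qed

end

section \<open>Shelling\<close>

text \<open>An element other than \<open>bot\<close> and \<open>top\<close> would give a chain of
  length 2, so any two elements are comparable. With at most one facet the shelling condition is
  vacuous, which settles the case where \<open>\<Omega>\<close> is arbitrary.\<close>

lemma maximal_chains_length_one:
  assumes "poset_length (UNIV :: 'a::{finite, order_bot, order_top} set) = 1"
  shows "maximal_chains \<subseteq> {UNIV :: 'a set}"
proof -
  have two: "x = bot \<or> x = top" for x :: 'a
  proof (rule ccontr)
    assume x: "\<not> (x = bot \<or> x = top)"
    then have "(bot :: 'a) \<noteq> top"
      using bot_least[of x] top_greatest[of x] order.antisym by metis
    with x have "is_chain UNIV {bot, x, top}" "card {bot, x, top} = 3"
      unfolding is_chain_iff by (auto simp: card_insert_if)
    then have "card {bot, x, top} - 1 \<le> poset_length (UNIV :: 'a set)"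
      unfolding poset_length_def by (intro Max_ge imageI CollectI) auto
    with \<open>card {bot, x, top} = 3\<close> assms show False by simp
  qed
  have cmp: "u \<le> w \<or> w \<le> u" for u w :: 'a
    using two[of u] two[of w] by auto
  show ?thesis unfolding maximal_chains_def is_maxchain_iff using cmp by auto
qed

text \<open>\<open>Fs ! j - {v}\<close> lies in the intersection, being a face of the earlier
  \<open>Fs ! k\<close>, and contains every face shared with \<open>Fs ! i\<close>. So each facet of
  the intersection has this form.\<close>

lemma shelling_orderI:
  assumes "distinct Fs" "set Fs = facets K" "\<And>F. F \<in> facets K \<Longrightarrow> finite F"
    and exch: "\<And>i j. i < j \<Longrightarrow> j < length Fs \<Longrightarrow>
      \<exists>k<j. \<exists>v\<in>Fs ! j. v \<notin> Fs ! i \<and> v \<notin> Fs ! k \<and> Fs ! j - {v} \<subseteq> Fs ! k"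
  shows "shelling_order K Fs"
  unfolding shelling_order_def
proof (intro conjI allI impI)
  fix j assume j: "0 < j \<and> j < length Fs"
  let ?I = "Pow (Fs ! j) \<inter> (\<Union>i<j. Pow (Fs ! i))"
  have fin: "finite (Fs ! j)" using assms(2,3) j nth_mem by blast
  have "face_dim F = face_dim (Fs ! j) - 1" if F: "F \<in> facets ?I" for F
  proof -
    from F obtain i where i: "i < j" "F \<subseteq> Fs ! i" "F \<subseteq> Fs ! j" unfolding facets_def by auto
    from exch[OF i(1)] j obtain k v where k: "k < j" "v \<in> Fs ! j" "v \<notin> Fs ! i"
      "Fs ! j - {v} \<subseteq> Fs ! k" by blast
    then have "Fs ! j - {v} \<in> ?I" "F \<subseteq> Fs ! j - {v}" using i by auto
    moreover have "\<forall>G\<in>?I. F \<subseteq> G \<longrightarrow> G = F" using F unfolding facets_def by simp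
    ultimately have "F = Fs ! j - {v}" by (metis (no_types))
    moreover have "card (Fs ! j) = Suc (card (Fs ! j - {v}))"
      using card.remove[OF fin k(2)] .
    ultimately show ?thesis unfolding face_dim_def by simp
  qed
  \<comment> \<open>\<open>pure_of_dim\<close> asks for a nonempty complex; the empty face provides
    this as soon as some facet comes earlier.\<close>
  moreover have "{} \<in> ?I" using j by auto
  ultimately show "pure_of_dim ?I (face_dim (Fs ! j) - 1)"
    unfolding pure_of_dim_def by blast
qed (use assms in auto)

theorem theorem5p13:
  fixes \<Omega> :: "'a::{finite, order_bot, order_top} set \<Rightarrow> 'a \<Rightarrow> 'a \<Rightarrow> 'a"
    and ms :: "'a set list"
  assumes "recursive_first_atom_set \<Omega>"
    and "linear_extension maximal_chains (chain_le \<Omega>) ms"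
  shows "shelling_order (order_complex (UNIV :: 'a set)) ms"
proof (rule shelling_orderI)
  from assms(2) have dist: "distinct ms" and set_ms: "set ms = maximal_chains"
    and lin: "\<And>i j. i < length ms \<Longrightarrow> j < length ms \<Longrightarrow> chain_le \<Omega> (ms ! i) (ms ! j) \<Longrightarrow> i \<le> j"
    unfolding linear_extension_def by blast+
  show "distinct ms" by (rule dist)
  show "set ms = facets (order_complex (UNIV :: 'a set))"
    unfolding facets_order_complex by (rule set_ms)
  show "finite F" for F :: "'a set" by simp
  fix i j assume ij: "i < j" "j < length ms"
  have ne: "ms ! i \<noteq> ms ! j" using dist ij by (simp add: nth_eq_iff_index_eq)
  have mi: "ms ! i \<in> maximal_chains" and mj: "ms ! j \<in> maximal_chains"
    using ij set_ms nth_mem by (metis order.strict_trans, metis)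
  \<comment> \<open>Two distinct maximal chains are at hand, which excludes length 1.\<close>
  have len: "poset_length (UNIV :: 'a set) \<noteq> 1"
    using maximal_chains_length_one[where 'a = 'a] mi mj ne by auto
  interpret first_atom_set \<Omega>
    using assms(1) len unfolding recursive_first_atom_set_def
    by unfold_locales simp_all
  \<comment> \<open>Smaller chains are listed first, so \<open>ms ! j\<close> is not below
    \<open>ms ! i\<close>; by contraposition it has a pseudo descent whose middle avoids
    \<open>ms ! i\<close>.\<close>
  have "\<not> chain_le \<Omega> (ms ! j) (ms ! i)" using lin[of j i] ij by auto
  then obtain u v w where pd: "pseudo_descent \<Omega> (ms ! j) u v w" "v \<notin> ms ! i"
    using chain_le_if_no_pseudo_descent[OF mi mj] by blast
  obtain k where k: "chain_step \<Omega> k (ms ! j)" "ms ! j - {v} \<subseteq> k" "v \<notin> k"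
    using pseudo_descent_chain_step[OF mj pd(1)] by blast
  have "k \<in> set ms" using k(1) set_ms unfolding chain_step_def by simp
  then obtain l where l: "l < length ms" "ms ! l = k" by (auto simp: in_set_conv_nth)
  have v: "v \<in> ms ! j" using pd(1) unfolding pseudo_descent_def by simp
  \<comment> \<open>The straightened chain is one step below \<open>ms ! j\<close>, hence listed no
    later, and it differs from \<open>ms ! j\<close> by missing \<open>v\<close>.\<close>
  have "l \<le> j" using lin[OF l(1) ij(2)] k(1) l(2) unfolding chain_le_def by auto
  moreover have "l \<noteq> j" using v k(3) l(2) by auto
  ultimately show "\<exists>l<j. \<exists>v\<in>ms ! j. v \<notin> ms ! i \<and> v \<notin> ms ! l \<and> ms ! j - {v} \<subseteq> ms ! l"
    using pd(2) v k l by (intro exI[of _ l]) auto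
qed

end
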